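(* Let $d\geq 1$ and let $D$ be an oriented graph with no directed triangle, of minimum semi-degree $d$ and of order $n=md$ with $m\leq 5$. Then the diameter of $D$ is at most $9$.
   Context: Digraphs have no loops and no parallel arcs. An oriented graph is a digraph in which for any two distinct vertices $x,y$ at most one of $(x,y),(y,x)$ is an arc. The minimum semi-degree of $D$ is the minimum of its minimum out-degree and its minimum in-degree. A directed triangle is a directed cycle of length $3$. The distance $d(x,y)$ is the length of a shortest directed path from $x$ to $y$, and the diameter is the maximum of $d(x,y)$ over all ordered pairs of vertices. *)

theory Defs
  imports "Graph_Theory.Graph_Theory" "HOL-Library.Extended_Nat"
begin

locale oriented_graph = digraph +
  assumes no_opposite_arcs:
    "\<lbrakk>x \<in> verts G; y \<in> verts G; x \<noteq> y\<rbrakk> \<Longrightarrow> \<not> (x \<rightarrow>\<^bsub>G\<^esub> y \<and> y \<rightarrow>\<^bsub>G\<^esub> x)"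

definition directed_triangle :: "('a, 'b) pre_digraph \<Rightarrow> 'b awalk \<Rightarrow> bool" where
  "directed_triangle G p \<longleftrightarrow> pre_digraph.cycle G p \<and> length p = 3"

definition min_out_degree :: "('a, 'b) pre_digraph \<Rightarrow> nat" where
  "min_out_degree G = Min (out_degree G ` verts G)"

definition min_in_degree :: "('a, 'b) pre_digraph \<Rightarrow> nat" where
  "min_in_degree G = Min (in_degree G ` verts G)"

definition min_semi_degree :: "('a, 'b) pre_digraph \<Rightarrow> nat" where
  "min_semi_degree G = min (min_out_degree G) (min_in_degree G)"

text \<open>The infimum of the empty set is \<open>\<infinity>\<close>, so the distance is infinite when there is no
  directed path, and a finite diameter entails strong connectivity.\<close>

definition digraph_dist :: "('a, 'b) pre_digraph \<Rightarrow> 'a \<Rightarrow> 'a \<Rightarrow> enat" where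
  "digraph_dist G x y = (INF p \<in> {p. pre_digraph.apath G x p y}. enat (length p))"

definition digraph_diameter :: "('a, 'b) pre_digraph \<Rightarrow> enat" where
  "digraph_diameter G = (SUP x \<in> verts G. SUP y \<in> verts G. digraph_dist G x y)"

end

theory Submission
  imports Defs
begin

text \<open>
  Suppose every nonempty finite set \<open>S\<close> has a vertex dominating at most \<open>c |S|\<close> of its members.
  For \<open>v \<in> S\<close> apply this to \<open>N\<^sup>+(v) \<inter> S\<close> and get \<open>u\<close>; since there is no directed
  triangle, \<open>N\<^sup>+(u)\<close> misses \<open>N\<^sup>-(v)\<close>, so \<open>N\<^sup>-(v)\<close>, \<open>N\<^sup>+(v)\<close> and most of \<open>N\<^sup>+(u)\<close> are
  disjoint parts of \<open>S\<close>. Summing over \<open>v\<close> bounds \<open>(2 - c) e(S) + \<delta> |S|\<close> by \<open>|S|\<^sup>2\<close>, where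
  \<open>\<delta>\<close> is the minimum out-degree inside \<open>S\<close> and \<open>e(S)\<close> its number of arcs. As
  \<open>e(S) \<ge> \<delta> |S|\<close>, the constant \<open>c\<close> improves to \<open>1 / (3 - c)\<close>, so the trivial value \<open>1\<close>
  becomes \<open>1/2\<close> and then \<open>2/5\<close>.

  Applied with \<open>c = 2/5\<close> to the out-ball of radius \<open>r\<close> around a vertex, in which the vertices
  of the ball of radius \<open>r - 1\<close> have full out-degree, the inequality forces the balls of radius
  \<open>4\<close> and \<open>5\<close> to have more than \<open>2.45 d\<close> and \<open>2.55 d\<close> vertices. By symmetry this holds for
  in-balls too, so among at most \<open>5 d\<close> vertices the out-ball of radius \<open>4\<close> around \<open>x\<close> meets the
  in-ball of radius \<open>5\<close> around \<open>y\<close>.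
\<close>

definition succs :: "('a \<Rightarrow> 'a \<Rightarrow> bool) \<Rightarrow> 'a set \<Rightarrow> 'a \<Rightarrow> 'a set" where
  "succs E S v = {w \<in> S. E v w}"

abbreviation preds :: "('a \<Rightarrow> 'a \<Rightarrow> bool) \<Rightarrow> 'a set \<Rightarrow> 'a \<Rightarrow> 'a set" where
  "preds E \<equiv> succs E\<inverse>\<inverse>"

definition min_out_ratio_le :: "('a \<Rightarrow> 'a \<Rightarrow> bool) \<Rightarrow> real \<Rightarrow> bool" where
  "min_out_ratio_le E c \<longleftrightarrow>
    (\<forall>S. finite S \<longrightarrow> S \<noteq> {} \<longrightarrow> (\<exists>u\<in>S. real (card (succs E S u)) \<le> c * real (card S)))"

lemma succs_subset: "succs E S v \<subseteq> S"
  by (auto simp: succs_def)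

lemma finite_succs [simp]: "finite S \<Longrightarrow> finite (succs E S v)"
  by (simp add: succs_def)

lemma card_succs_le: "finite S \<Longrightarrow> card (succs E S v) \<le> card S"
  by (simp add: card_mono succs_subset)

lemma card_succs_superset_le:
  assumes "finite C" "B \<subseteq> C"
  shows "card (succs E C v) \<le> card (succs E B v) + (card C - card B)"
proof -
  have "finite B"
    using assms by (rule finite_subset[rotated])
  then have "card (succs E C v) \<le> card (succs E B v \<union> (C - B))"
    using \<open>finite C\<close> by (intro card_mono) (auto simp: succs_def)
  also have "\<dots> \<le> card (succs E B v) + card (C - B)"
    by (rule card_Un_le)
  also have "card (C - B) = card C - card B"
    using \<open>finite B\<close> \<open>B \<subseteq> C\<close> by (rule card_Diff_subset)
  finally show ?thesis .
qed

lemma sum_card_preds: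
  assumes "finite S"
  shows "(\<Sum>v\<in>S. card (preds E S v)) = (\<Sum>v\<in>S. card (succs E S v))"
  unfolding succs_def conversep_iff by (rule sum_multicount_gen) (use assms in auto)

lemma min_out_ratio_le_one: "min_out_ratio_le E 1"
  by (auto simp: min_out_ratio_le_def card_succs_le)

locale triangle_free_relation =
  fixes E :: "'a \<Rightarrow> 'a \<Rightarrow> bool"
  assumes asym: "E a b \<Longrightarrow> \<not> E b a"
    and no_triangle: "E a b \<Longrightarrow> E b c \<Longrightarrow> \<not> E c a"
begin

lemma triangle_free_relation_conversep: "triangle_free_relation E\<inverse>\<inverse>"
  by unfold_locales (auto dest: asym no_triangle)

lemma card_preds_succs_succs_le:
  assumes "finite S" "u \<in> succs E S v"
  shows "card (preds E S v) + card (succs E S v) + card (succs E S u)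
    \<le> card S + card (succs E (succs E S v) u)"
proof -
  let ?new = "succs E S u - succs E S v"
  have disjoint: "preds E S v \<inter> succs E S v = {}" "(preds E S v \<union> succs E S v) \<inter> ?new = {}"
    using asym no_triangle assms(2) unfolding succs_def conversep_iff by blast+
  have "card (preds E S v) + card (succs E S v) + card ?new
      = card (preds E S v \<union> succs E S v \<union> ?new)"
    using \<open>finite S\<close> disjoint by (simp add: card_Un_disjoint)
  also have "\<dots> \<le> card S"
    using \<open>finite S\<close> by (intro card_mono) (auto simp: succs_def)
  finally have "card (preds E S v) + card (succs E S v) + card ?new \<le> card S" .
  moreover have "succs E S u \<inter> succs E S v = succs E (succs E S v) u"
    by (auto simp: succs_def)
  then have "card (succs E S u) = card (succs E (succs E S v) u) + card ?new"
    using card_Int_Diff[of "succs E S u" "succs E S v"] \<open>finite S\<close> by simp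
  ultimately show ?thesis
    by simp
qed

lemma card_preds_succs_le:
  assumes "min_out_ratio_le E c" "finite S" "v \<in> S"
    and min_deg: "\<And>u. u \<in> S \<Longrightarrow> \<delta> \<le> real (card (succs E S u))"
  shows "real (card (preds E S v)) + (1 - c) * real (card (succs E S v)) + \<delta> \<le> real (card S)"
proof (cases "succs E S v = {}")
  case True
  then have "\<delta> \<le> 0"
    using min_deg[OF \<open>v \<in> S\<close>] by simp
  then show ?thesis
    using True card_succs_le[OF \<open>finite S\<close>, of "E\<inverse>\<inverse>" v] by simp
next
  case False
  obtain u where u: "u \<in> succs E S v"
    and few: "real (card (succs E (succs E S v) u)) \<le> c * real (card (succs E S v))"
    using assms(1) finite_succs[OF \<open>finite S\<close>] False unfolding min_out_ratio_le_def by blast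
  have "\<delta> \<le> real (card (succs E S u))"
    using u by (intro min_deg) (simp add: succs_def)
  moreover have "real (card (preds E S v)) + real (card (succs E S v)) + real (card (succs E S u))
      \<le> real (card S) + real (card (succs E (succs E S v) u))"
    using card_preds_succs_succs_le[OF \<open>finite S\<close> u] by linarith
  ultimately show ?thesis
    using few by (simp add: algebra_simps)
qed

lemma arc_count_le:
  assumes "min_out_ratio_le E c" "finite S"
    and "\<And>u. u \<in> S \<Longrightarrow> \<delta> \<le> real (card (succs E S u))"
  shows "(2 - c) * (\<Sum>v\<in>S. real (card (succs E S v))) + \<delta> * real (card S) \<le> (real (card S))\<^sup>2"
proof -
  have "(\<Sum>v\<in>S. real (card (preds E S v))) = (\<Sum>v\<in>S. real (card (succs E S v)))"
    using arg_cong[OF sum_card_preds[OF \<open>finite S\<close>], of real] by simp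
  then have "(2 - c) * (\<Sum>v\<in>S. real (card (succs E S v))) + \<delta> * real (card S)
      = (\<Sum>v\<in>S. real (card (preds E S v)) + (1 - c) * real (card (succs E S v)) + \<delta>)"
    by (simp add: sum.distrib sum_distrib_left[symmetric]) (simp add: algebra_simps)
  also have "\<dots> \<le> (\<Sum>v\<in>S. real (card S))"
    using assms by (intro sum_mono card_preds_succs_le) auto
  finally show ?thesis
    by (simp add: power2_eq_square)
qed

lemma min_out_ratio_le_improve:
  assumes "min_out_ratio_le E c" "c < 2"
  shows "min_out_ratio_le E (1 / (3 - c))"
  unfolding min_out_ratio_le_def
proof (intro allI impI, rule ccontr)
  fix S :: "'a set"
  let ?n = "real (card S)" and ?arcs = "\<Sum>v\<in>S. real (card (succs E S v))"
  assume nonempty: "finite S" "S \<noteq> {}"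
    and no_small: "\<not> (\<exists>u\<in>S. real (card (succs E S u)) \<le> 1 / (3 - c) * ?n)"
  define \<delta> where "\<delta> = 1 / (3 - c) * ?n"
  have min_deg: "\<delta> < real (card (succs E S v))" if "v \<in> S" for v
    using that no_small by (fastforce simp: \<delta>_def)
  have "(\<Sum>v\<in>S. \<delta>) < ?arcs"
    using nonempty min_deg by (intro sum_strict_mono) auto
  then have "(2 - c) * (\<Sum>v\<in>S. \<delta>) < (2 - c) * ?arcs"
    using \<open>c < 2\<close> by (intro mult_strict_left_mono) auto
  moreover have "(2 - c) * ?arcs + \<delta> * ?n \<le> ?n\<^sup>2"
    using assms(1) nonempty(1) min_deg by (intro arc_count_le) (auto intro: less_imp_le)
  ultimately have "(3 - c) * \<delta> * ?n < ?n\<^sup>2"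
    by (simp add: algebra_simps)
  then show False
    using \<open>c < 2\<close> by (simp add: \<delta>_def power2_eq_square)
qed

lemma min_out_ratio_le_two_fifths: "min_out_ratio_le E (2/5)"
proof -
  have "min_out_ratio_le E (1/2)"
    using min_out_ratio_le_improve[OF min_out_ratio_le_one] by simp
  from min_out_ratio_le_improve[OF this] show ?thesis
    by simp
qed

lemma nested_card_growth:
  fixes d :: nat
  assumes ratio: "min_out_ratio_le E \<kappa>" "\<kappa> \<le> 2"
    and "finite C" "A \<subseteq> B" "B \<subseteq> C"
    and full_deg_A: "\<And>v. v \<in> A \<Longrightarrow> d \<le> card (succs E B v)"
    and full_deg_B: "\<And>v. v \<in> B \<Longrightarrow> d \<le> card (succs E C v)"
  defines "a \<equiv> real (card A)" and "b \<equiv> real (card B)" and "c \<equiv> real (card C)"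
  shows "(2 - \<kappa>) * (b\<^sup>2 + a * (c - b)) \<le> (3 - \<kappa>) * b * (c - d)"
proof -
  let ?deg = "\<lambda>v. real (card (succs E B v))"
  have fin: "finite B" "finite A"
    using assms(3-5) by (meson finite_subset)+
  have min_deg_B: "d - (c - b) \<le> ?deg v" if "v \<in> B" for v
    using full_deg_B[OF that] card_succs_superset_le[OF \<open>finite C\<close> \<open>B \<subseteq> C\<close>, of E v]
      card_mono[OF \<open>finite C\<close> \<open>B \<subseteq> C\<close>]
    by (simp add: b_def c_def)
  have "b * d - (b - a) * (c - b) = (\<Sum>v\<in>A. real d) + (\<Sum>v\<in>B - A. d - (c - b))"
    using fin \<open>A \<subseteq> B\<close>
    by (simp add: card_Diff_subset of_nat_diff card_mono a_def b_def algebra_simps)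
  also have "\<dots> \<le> (\<Sum>v\<in>A. ?deg v) + (\<Sum>v\<in>B - A. ?deg v)"
    using full_deg_A min_deg_B by (intro add_mono sum_mono) auto
  also have "\<dots> = (\<Sum>v\<in>B. ?deg v)"
    using fin \<open>A \<subseteq> B\<close> by (metis add.commute sum.subset_diff)
  finally have "(2 - \<kappa>) * (b * d - (b - a) * (c - b)) \<le> (2 - \<kappa>) * (\<Sum>v\<in>B. ?deg v)"
    using ratio(2) by (intro mult_left_mono) auto
  also have "\<dots> \<le> b\<^sup>2 - (d - (c - b)) * b"
    using arc_count_le[OF ratio(1) fin(1) min_deg_B] by (simp add: b_def)
  finally show ?thesis
    by (simp add: algebra_simps power2_eq_square)
qed

end

text \<open>The hypotheses \<open>violated\<close> and \<open>slope\<close> say \<open>F Q > 0\<close> and \<open>F' Q \<ge> 0\<close> for the convex quadratic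
  \<open>F b\<close> that is the left minus the right side of \<open>ineq\<close> at \<open>a = P\<close>, \<open>c = R\<close>, \<open>d = 1\<close>.\<close>

lemma gt_of_growth_inequality:
  fixes a b c d s P Q R :: "'a::linordered_idom"
  assumes ineq: "s * (b\<^sup>2 + a * (c - b)) \<le> (1 + s) * b * (c - d)"
    and violated: "(1 + s) * Q * (R - 1) < s * (Q\<^sup>2 + P * (R - Q))"
    and slope: "(1 + s) * (R - 1) \<le> s * (2 * Q - P)"
    and nonneg: "0 \<le> s" "0 \<le> Q" and "0 < d"
    and lower: "P * d \<le> a" "Q * d \<le> b"
    and ordered: "a \<le> b" "b \<le> c"
  shows "R * d < c"
proof (rule ccontr)
  assume "\<not> ?thesis"
  then have not_larger: "c \<le> R * d" by simp
  have "0 \<le> b"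
    using nonneg(2) \<open>0 < d\<close> lower(2) by (meson less_imp_le mult_nonneg_nonneg order_trans)
  have "s * (P * d) \<le> s * b"
    using nonneg(1) lower(1) ordered(1) by (intro mult_left_mono) auto
  also have "\<dots> \<le> (1 + s) * b"
    using \<open>0 \<le> b\<close> by (simp add: algebra_simps)
  finally have "0 \<le> (R * d - c) * ((1 + s) * b - s * (P * d))"
    using not_larger by simp
  moreover have "0 \<le> s * ((a - P * d) * (c - b))"
    using nonneg(1) lower(1) ordered(2) by simp
  ultimately have upper: "s * (b\<^sup>2 + P * d * (R * d - b)) \<le> (1 + s) * b * (R * d - d)"
    using ineq by (simp add: algebra_simps)
  define h where "h = b - Q * d"
  have "0 < (s * (Q\<^sup>2 + P * (R - Q)) - (1 + s) * Q * (R - 1)) * d\<^sup>2"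
    using violated \<open>0 < d\<close> by simp
  moreover have "0 \<le> (s * (2 * Q - P) - (1 + s) * (R - 1)) * (h * d)"
    using slope lower(2) \<open>0 < d\<close> by (simp add: h_def)
  moreover have "0 \<le> s * h\<^sup>2"
    using nonneg(1) by simp
  ultimately have "(1 + s) * b * (R * d - d) < s * (b\<^sup>2 + P * d * (R * d - b))"
    unfolding h_def by (simp add: algebra_simps power2_eq_square)
  with upper show False by simp
qed

definition expanding_chain :: "('a \<Rightarrow> 'a \<Rightarrow> bool) \<Rightarrow> nat \<Rightarrow> (nat \<Rightarrow> 'a set) \<Rightarrow> bool" where
  "expanding_chain E d B \<longleftrightarrow> B 0 \<noteq> {} \<and>
    (\<forall>r. finite (B r) \<and> B r \<subseteq> B (Suc r) \<and> (\<forall>v\<in>B r. d \<le> card (succs E (B (Suc r)) v)))"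

lemma (in triangle_free_relation) expanding_chain_card_step:
  fixes P Q R :: real
  assumes chain: "expanding_chain E d B" and "0 < d"
    and ratio: "min_out_ratio_le E \<kappa>" "\<kappa> \<le> 2"
    and lower: "P * d \<le> card (B r)" "Q * d \<le> card (B (r + 1))" and "0 \<le> Q"
    and violated: "(3 - \<kappa>) * Q * (R - 1) < (2 - \<kappa>) * (Q\<^sup>2 + P * (R - Q))"
    and slope: "(3 - \<kappa>) * (R - 1) \<le> (2 - \<kappa>) * (2 * Q - P)"
  shows "R * d < card (B (r + 2))"
proof (rule gt_of_growth_inequality)
  let ?b = "\<lambda>r. real (card (B r))"
  have fin: "finite (B r)" and sub: "B r \<subseteq> B (Suc r)"
    and deg: "v \<in> B r \<Longrightarrow> d \<le> card (succs E (B (Suc r)) v)" for r v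
    using chain by (auto simp: expanding_chain_def)
  show "(2 - \<kappa>) * ((?b (r + 1))\<^sup>2 + ?b r * (?b (r + 2) - ?b (r + 1)))
      \<le> (1 + (2 - \<kappa>)) * ?b (r + 1) * (?b (r + 2) - real d)"
    using nested_card_growth[OF ratio fin sub sub deg deg, of r] by simp
  show "?b r \<le> ?b (r + 1)" "?b (r + 1) \<le> ?b (r + 2)"
    using fin sub by (simp_all add: card_mono)
qed (use assms in auto)

lemma (in triangle_free_relation) expanding_chain_card_gt:
  assumes chain: "expanding_chain E d B" and "0 < d"
  shows "49/20 * real d < card (B 4)" and "51/20 * real d < card (B 5)"
proof -
  let ?b = "\<lambda>r. real (card (B r))"
  note growth = expanding_chain_card_step[OF assms min_out_ratio_le_two_fifths]
  obtain x where "x \<in> B 0"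
    using chain by (auto simp: expanding_chain_def)
  then have "d \<le> card (succs E (B (Suc 0)) x)"
    using chain by (simp add: expanding_chain_def)
  also have "\<dots> \<le> card (B (Suc 0))"
    using chain by (simp add: expanding_chain_def card_succs_le)
  finally have card_1: "real d \<le> ?b 1"
    by simp
  have card_2: "8/5 * real d < ?b 2"
    using growth[where P = 0 and r = 0 and Q = 1 and R = "8/5"] card_1
    by (simp add: power2_eq_square numeral_2_eq_2)
  have card_3: "11/5 * real d < ?b 3"
    using growth[where P = 1 and r = 1 and Q = "8/5" and R = "11/5"] card_1 card_2
    by (simp add: power2_eq_square numeral_2_eq_2 numeral_3_eq_3)
  show card_4: "49/20 * real d < ?b 4"
    using growth[where P = "8/5" and r = 2 and Q = "11/5" and R = "49/20"] card_2 card_3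
    by (simp add: power2_eq_square)
  show "51/20 * real d < ?b 5"
    using growth[where P = "11/5" and r = 3 and Q = "49/20" and R = "51/20"] card_3 card_4
    by (simp add: power2_eq_square)
qed

definition rel_ball :: "('a \<Rightarrow> 'a \<Rightarrow> bool) \<Rightarrow> 'a \<Rightarrow> nat \<Rightarrow> 'a set" where
  "rel_ball E x r = {w. \<exists>k\<le>r. (E ^^ k) x w}"

lemma rel_ball_subset:
  assumes "x \<in> V" "\<And>v w. E v w \<Longrightarrow> w \<in> V"
  shows "rel_ball E x r \<subseteq> V"
proof
  fix w assume "w \<in> rel_ball E x r"
  then obtain k where "(E ^^ k) x w"
    by (auto simp: rel_ball_def)
  then show "w \<in> V"
    using assms by (cases k) auto
qed

lemma rel_ball_step: "v \<in> rel_ball E x r \<Longrightarrow> E v w \<Longrightarrow> w \<in> rel_ball E x (Suc r)"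
  unfolding rel_ball_def by (blast intro: relpowp_Suc_I Suc_le_mono[THEN iffD2])

lemma expanding_chain_rel_ball:
  assumes "finite V" "x \<in> V" "\<And>v w. E v w \<Longrightarrow> w \<in> V"
    and deg: "\<And>v. v \<in> V \<Longrightarrow> d \<le> card {w. E v w}"
  shows "expanding_chain E d (rel_ball E x)"
proof -
  have sub: "rel_ball E x r \<subseteq> V" for r
    using assms by (intro rel_ball_subset) auto
  have "x \<in> rel_ball E x 0"
    by (simp add: rel_ball_def)
  moreover have "finite (rel_ball E x r)" for r
    using sub \<open>finite V\<close> by (rule finite_subset)
  moreover have "rel_ball E x r \<subseteq> rel_ball E x (Suc r)" for r
    by (auto simp: rel_ball_def intro: le_SucI)
  moreover have "d \<le> card (succs E (rel_ball E x (Suc r)) v)" if "v \<in> rel_ball E x r" for r v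
  proof -
    have "succs E (rel_ball E x (Suc r)) v = {w. E v w}"
      using rel_ball_step[OF that] by (auto simp: succs_def)
    then show ?thesis
      using deg sub that by auto
  qed
  ultimately show ?thesis
    by (auto simp: expanding_chain_def)
qed

lemma relpowp_conversep:
  fixes E :: "'a \<Rightarrow> 'a \<Rightarrow> bool"
  shows "E\<inverse>\<inverse> ^^ k = (E ^^ k)\<inverse>\<inverse>"
proof (induction k)
  case (Suc k)
  have "E\<inverse>\<inverse> ^^ Suc k = (E ^^ k)\<inverse>\<inverse> OO E\<inverse>\<inverse>"
    by (simp only: relpowp.simps Suc)
  also have "\<dots> = (E ^^ Suc k)\<inverse>\<inverse>"
    by (simp only: relpowp_Suc_left converse_relcompp)
  finally show ?case .
qed simp

lemma rel_balls_meet: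
  assumes "z \<in> rel_ball E x r" "z \<in> rel_ball E\<inverse>\<inverse> y s"
  obtains k where "k \<le> r + s" "(E ^^ k) x y"
proof -
  obtain i j where "i \<le> r" "(E ^^ i) x z" "j \<le> s" "(E ^^ j) z y"
    using assms by (auto simp: rel_ball_def relpowp_conversep)
  then have "i + j \<le> r + s" "(E ^^ (i + j)) x y"
    by (auto intro: relpowp_trans)
  then show thesis by (rule that)
qed

lemma (in triangle_free_relation) relpowp_le_9:
  assumes "finite V" and arcs_in: "\<And>v w. E v w \<Longrightarrow> v \<in> V \<and> w \<in> V"
    and xy: "x \<in> V" "y \<in> V"
    and out_deg: "\<And>v. v \<in> V \<Longrightarrow> d \<le> card {w. E v w}"
    and in_deg: "\<And>v. v \<in> V \<Longrightarrow> d \<le> card {w. E w v}"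
    and "0 < d" and card: "card V \<le> 5 * d"
  obtains k where "k \<le> 9" "(E ^^ k) x y"
proof -
  interpret conv: triangle_free_relation "E\<inverse>\<inverse>"
    by (rule triangle_free_relation_conversep)
  let ?X = "rel_ball E x 4" and ?Y = "rel_ball E\<inverse>\<inverse> y 5"
  have "49/20 * real d < card ?X"
    using \<open>finite V\<close> arcs_in xy out_deg \<open>0 < d\<close>
    by (intro expanding_chain_card_gt expanding_chain_rel_ball) auto
  moreover have "51/20 * real d < card ?Y"
    using \<open>finite V\<close> arcs_in xy in_deg \<open>0 < d\<close>
    by (intro conv.expanding_chain_card_gt expanding_chain_rel_ball) auto
  ultimately have "card V < card ?X + card ?Y"
    using card by linarith
  moreover have "?X \<subseteq> V" "?Y \<subseteq> V"
    using arcs_in xy by (intro rel_ball_subset; auto)+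
  then have "card ?X + card ?Y \<le> card V" if "?X \<inter> ?Y = {}"
    using that \<open>finite V\<close> by (metis Un_least card_Un_disjoint card_mono finite_subset)
  ultimately obtain z where "z \<in> ?X" "z \<in> ?Y"
    by fastforce
  then show thesis
    by (rule rel_balls_meet) (rule that, auto)
qed

lemma (in wf_digraph) length_awalk_to_apath_le:
  assumes "awalk u p v"
  shows "length (awalk_to_apath p) \<le> length p"
proof -
  have cost: "awalk_cost (\<lambda>_. 1) q = real (length q)" for q :: "'b awalk"
    by (induction q) simp_all
  show ?thesis
    using awalk_to_path_no_neg_cyc_cost[OF assms, of "\<lambda>_. 1"] unfolding cost by simp
qed

lemma (in wf_digraph) relpowp_dominates_imp_awalk:
  assumes "(dominates G ^^ k) u v" "v \<in> verts G"
  shows "\<exists>p. awalk u p v \<and> length p = k"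
  using assms
proof (induction k arbitrary: u)
  case 0
  then show ?case
    by (auto simp: awalk_Nil_iff)
next
  case (Suc k)
  then obtain w where "u \<rightarrow>\<^bsub>G\<^esub> w" "(dominates G ^^ k) w v"
    by (meson relpowp_Suc_D2)
  moreover from this Suc obtain p where "awalk w p v" "length p = k" by blast
  moreover from \<open>u \<rightarrow>\<^bsub>G\<^esub> w\<close> obtain e where "e \<in> arcs G" "tail G e = u" "head G e = w"
    by (auto simp: arcs_ends_conv)
  ultimately show ?case
    by (intro exI[of _ "e # p"]) (auto simp: awalk_Cons_iff)
qed

lemma (in wf_digraph) digraph_dist_le_of_relpowp:
  assumes "(dominates G ^^ k) u v" "v \<in> verts G"
  shows "digraph_dist G u v \<le> enat k"
proof -
  obtain p where p: "awalk u p v" "length p = k"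
    using relpowp_dominates_imp_awalk[OF assms] by blast
  have "digraph_dist G u v \<le> enat (length (awalk_to_apath p))"
    using apath_awalk_to_apath[OF p(1)] unfolding digraph_dist_def by (intro INF_lower) simp
  also have "\<dots> \<le> enat k"
    using length_awalk_to_apath_le[OF p(1)] p(2) by simp
  finally show ?thesis .
qed

lemma (in nomulti_digraph) out_degree_eq_card: "out_degree G v = card {w. v \<rightarrow>\<^bsub>G\<^esub> w}"
proof -
  have "{w. v \<rightarrow>\<^bsub>G\<^esub> w} = head G ` out_arcs G v"
    by (auto simp: arcs_ends_conv)
  moreover have "inj_on (head G) (out_arcs G v)"
    by (auto simp: inj_on_def arc_to_ends_def intro: no_multi_arcs)
  ultimately show ?thesis
    by (simp add: out_degree_def card_image)
qed

lemma (in nomulti_digraph) in_degree_eq_card: "in_degree G v = card {w. w \<rightarrow>\<^bsub>G\<^esub> v}"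
proof -
  have "{w. w \<rightarrow>\<^bsub>G\<^esub> v} = tail G ` in_arcs G v"
    by (auto simp: arcs_ends_conv)
  moreover have "inj_on (tail G) (in_arcs G v)"
    by (auto simp: inj_on_def arc_to_ends_def intro: no_multi_arcs)
  ultimately show ?thesis
    by (simp add: in_degree_def card_image)
qed

lemma (in fin_digraph) min_semi_degree_le:
  assumes "v \<in> verts G"
  shows "min_semi_degree G \<le> out_degree G v" "min_semi_degree G \<le> in_degree G v"
  using assms
  by (auto simp: min_semi_degree_def min_out_degree_def min_in_degree_def
      intro: min.coboundedI1 min.coboundedI2)

lemma (in loopfree_digraph) directed_triangle_of_dominates:
  assumes "a \<rightarrow>\<^bsub>G\<^esub> b" "b \<rightarrow>\<^bsub>G\<^esub> c" "c \<rightarrow>\<^bsub>G\<^esub> a"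
  obtains p where "directed_triangle G p"
proof -
  obtain e f g where "e \<in> arcs G" "tail G e = a" "head G e = b"
      "f \<in> arcs G" "tail G f = b" "head G f = c" "g \<in> arcs G" "tail G g = c" "head G g = a"
    using assms by (auto simp: arcs_ends_conv)
  then have "cycle [e, f, g]"
    using assms unfolding cycle_def
    by (intro exI[of _ a]) (auto simp: awalk_simps dest: adj_not_same)
  then show thesis
    by (intro that[of "[e, f, g]"]) (simp add: directed_triangle_def)
qed

lemma (in oriented_graph) triangle_free_relation_dominates:
  assumes "\<nexists>p. directed_triangle G p"
  shows "triangle_free_relation (dominates G)"
proof
  show "\<not> b \<rightarrow>\<^bsub>G\<^esub> a" if "a \<rightarrow>\<^bsub>G\<^esub> b" for a b
    using that no_opposite_arcs adj_in_verts adj_not_same by metis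
  show "\<not> c \<rightarrow>\<^bsub>G\<^esub> a" if "a \<rightarrow>\<^bsub>G\<^esub> b" "b \<rightarrow>\<^bsub>G\<^esub> c" for a b c
    using that assms directed_triangle_of_dominates by blast
qed

lemma (in oriented_graph) digraph_dist_le_9:
  assumes "\<nexists>p. directed_triangle G p"
    and "0 < min_semi_degree G" and "card (verts G) \<le> 5 * min_semi_degree G"
    and xy: "x \<in> verts G" "y \<in> verts G"
  shows "digraph_dist G x y \<le> 9"
proof -
  interpret triangle_free_relation "dominates G"
    by (rule triangle_free_relation_dominates) fact
  have deg: "min_semi_degree G \<le> card {w. v \<rightarrow>\<^bsub>G\<^esub> w}" "min_semi_degree G \<le> card {w. w \<rightarrow>\<^bsub>G\<^esub> v}"
    if "v \<in> verts G" for v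
    using min_semi_degree_le[OF that] by (simp_all add: out_degree_eq_card in_degree_eq_card)
  obtain k where "k \<le> 9" "(dominates G ^^ k) x y"
    by (rule relpowp_le_9[of "verts G" x y "min_semi_degree G"])
      (use assms(2,3) xy adj_in_verts deg in auto)
  then have "digraph_dist G x y \<le> enat k"
    using digraph_dist_le_of_relpowp xy by blast
  also have "\<dots> \<le> 9"
    using \<open>k \<le> 9\<close> by (simp add: numeral_eq_enat)
  finally show ?thesis .
qed

theorem theorem1p7:
  fixes D :: "('a, 'b) pre_digraph" and d :: nat and m :: real
  assumes "d \<ge> 1"
    and "oriented_graph D"
    and "\<nexists>p. directed_triangle D p"
    and "min_semi_degree D = d"
    and "real (card (verts D)) = m * real d"
    and "m \<le> 5"
  shows "digraph_diameter D \<le> 9"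
proof -
  interpret oriented_graph D by fact
  have "real (card (verts D)) \<le> 5 * real d"
    using assms(5,6) by (simp add: mult_right_mono)
  then have "card (verts D) \<le> 5 * min_semi_degree D"
    using assms(4) by linarith
  then have "digraph_dist D x y \<le> 9" if "x \<in> verts D" "y \<in> verts D" for x y
    using that assms(1,3,4) by (intro digraph_dist_le_9) auto
  then show ?thesis
    unfolding digraph_diameter_def by (intro SUP_least)
qed

end
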